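(* For every complex $s$ with $0<\mathrm{Re}(s)<1$, $$\eta(s)+\eta(1-s)=\lim_{m\to\infty}\Bigg\{\left(\frac{\chi(m+1)}{(m+1)!}+\frac{\pi}{\left[\left(\frac{m-1}{2}\right)!\right]^2}\right)\left[\prod_{j=0}^{m-1}(j+2+d_j-s)+\prod_{j=0}^{m-1}(j+1+d_j+s)\right]-\frac{\pi}{\left[\left(\frac{m-1}{2}\right)!\right]^2}\left[\prod_{j=0}^{m-1}\left(j+\tfrac52-s\right)+\prod_{j=0}^{m-1}\left(j+\tfrac32+s\right)\right]\Bigg\},$$ where the limit is over even positive integers $m$ and $d_j=d_j^{(m)}\in(0,1)$ are the numbers defined in the context; moreover, for each such $m$, all zeros in $s$ of each of the two polynomials in square brackets (the two symmetrized factorials) have real part $\tfrac12$.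
   Context: $\eta(s)=\sum_{n=1}^\infty (-1)^{n+1}n^{-s}=(1-2^{1-s})\zeta(s)$ (for $\mathrm{Re}(s)>0$) is the Dirichlet eta function, and $x!=\Gamma(x+1)$ for non-integer $x$. For $n\ge 1$, $$\chi(n)=\sum_{j=2}^{\infty}(-1)^{j-1}\frac{n}{j^2}\left(1-\frac1j\right)^{n-1}.$$ For an even positive integer $m$ and $0\le k\le m$, put $$\epsilon_k=\frac{1}{k!\,(m-k)!}\left((-1)^k\eta(k+2)+\frac{(k-\frac12)!\,(m-k-\frac12)!}{\left[\left(\frac{m-1}{2}\right)!\right]^2}\right).$$ These are positive, so the degree-$m$ polynomial $\sum_{k=0}^{m}\epsilon_k\prod_{0\le j\le m,\,j\ne k}(j+2-s)$ has exactly one zero in each open interval $(j+2,j+3)$, $0\le j\le m-1$; this zero is written $j+2+d_j$, so $0<d_j<1$. *)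

theory Defs
  imports "HOL-Analysis.Analysis"
begin

text \<open>The series is only conditionally convergent for \<open>0 < Re s \<le> 1\<close>, so it is summed in
  its natural order; the summation index is shifted by one.  The definition is polymorphic so that
  it provides both the complex function and its real values at real arguments.\<close>

definition dirichlet_eta :: "'a::{real_normed_field,ln} \<Rightarrow> 'a" where
  "dirichlet_eta s = (\<Sum>n. (-1) ^ n * of_nat (Suc n) powr (- s))"

definition gfact :: "real \<Rightarrow> real" where
  "gfact x = Gamma (x + 1)"

text \<open>The summation index \<open>i\<close> stands for \<open>j - 2\<close>, where \<open>j \<ge> 2\<close>.\<close>

definition chi :: "nat \<Rightarrow> real" where
  "chi n = (\<Sum>i. (-1) ^ (i + 1) * (real n / real (i + 2) ^ 2) * (1 - 1 / real (i + 2)) ^ (n - 1))"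

definition eps :: "nat \<Rightarrow> nat \<Rightarrow> real" where
  "eps m k = 1 / (fact k * fact (m - k)) *
     ((-1) ^ k * dirichlet_eta (real (k + 2)) +
      gfact (real k - 1/2) * gfact (real m - real k - 1/2) / (gfact ((real m - 1) / 2))\<^sup>2)"

definition eps_poly :: "nat \<Rightarrow> real \<Rightarrow> real" where
  "eps_poly m x = (\<Sum>k\<le>m. eps m k * (\<Prod>j\<in>{..m} - {k}. real j + 2 - x))"

text \<open>For even \<open>m > 0\<close> and \<open>j < m\<close> all \<open>eps m k\<close> are positive, so \<open>eps_poly m\<close> has exactly one
  zero in the open interval from \<open>j + 2\<close> to \<open>j + 3\<close>.  Only these \<open>m\<close> and \<open>j\<close> are relevant.\<close>

definition dshift :: "nat \<Rightarrow> nat \<Rightarrow> real" where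
  "dshift m j = (THE d. 0 < d \<and> d < 1 \<and> eps_poly m (real j + 2 + d) = 0)"

definition symfact_d :: "nat \<Rightarrow> complex \<Rightarrow> complex" where
  "symfact_d m s = (\<Prod>j<m. of_nat j + 2 + of_real (dshift m j) - s) +
                   (\<Prod>j<m. of_nat j + 1 + of_real (dshift m j) + s)"

definition symfact_half :: "nat \<Rightarrow> complex \<Rightarrow> complex" where
  "symfact_half m s = (\<Prod>j<m. of_nat j + 5/2 - s) + (\<Prod>j<m. of_nat j + 3/2 + s)"

definition eta_approx :: "nat \<Rightarrow> complex \<Rightarrow> complex" where
  "eta_approx m s =
     of_real (chi (m + 1) / fact (m + 1) + pi / (gfact ((real m - 1) / 2))\<^sup>2) * symfact_d m s -
     of_real (pi / (gfact ((real m - 1) / 2))\<^sup>2) * symfact_half m s"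

end

theory Submission
  imports Defs
begin

text \<open>
  For even \<open>m\<close> the expression under the limit is \<open>A\<^sub>m(s) + A\<^sub>m(1 - s)\<close>, where \<open>A\<^sub>m\<close> is the
  polynomial of degree at most \<open>m\<close> that interpolates \<open>\<eta>\<close> at \<open>2, 3, \<dots>, m + 2\<close>.  To see this, read
  the definition of the coefficients \<open>\<epsilon>\<^sub>k\<close> as Lagrange interpolation.  The summand \<open>\<eta>(k + 2)\<close> of
  \<open>\<epsilon>\<^sub>k\<close> contributes \<open>A\<^sub>m\<close>.  By the reflection formula the Gamma summand is, up to sign, the value at
  \<open>k + 2\<close> of \<open>B\<^sub>m(s) = \<pi> / [((m - 1)/2)!]\<^sup>2 \<Prod>(j + 5/2 - s)\<close>, so it contributes \<open>B\<^sub>m\<close>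
  (\<open>eps_poly_eq_interpolation\<close>).  The factorization of \<open>A\<^sub>m + B\<^sub>m\<close> into linear factors has the
  zeros \<open>j + 2 + d\<^sub>j\<close>, and its leading coefficient is \<open>\<chi>(m + 1)/(m + 1)!\<close>, from \<open>A\<^sub>m\<close>, plus
  \<open>\<pi> / [((m - 1)/2)!]\<^sup>2\<close>, from \<open>B\<^sub>m\<close> (\<open>dshift_props\<close>).  Subtracting \<open>B\<^sub>m\<close> leaves \<open>A\<^sub>m\<close>.

  In Newton's form \<open>A\<^sub>m(s)\<close> is a partial sum of the series of the terms
  \<open>(-1)\<^sup>k (s - 2 choose k) a\<^sub>k\<close> with \<open>a\<^sub>k = \<Sum>\<^sub>n (-1)\<^sup>n\<^sup>+\<^sup>1 n\<^sup>-\<^sup>2 (1 - 1/n)\<^sup>k\<close>, which arises from \<open>\<eta>(s)\<close> by the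
  binomial expansion of \<open>n\<^sup>-\<^sup>s = n\<^sup>-\<^sup>2 (1 - (1 - 1/n))\<^sup>s\<^sup>-\<^sup>2\<close> and an exchange of the two sums.  The
  exchange needs cancellation in the sum over \<open>n\<close>: the sequence \<open>n\<^sup>-\<^sup>2 (1 - 1/n)\<^sup>k\<close> is unimodal in \<open>n\<close>
  with maximum \<open>O(k\<^sup>-\<^sup>2)\<close>, so all partial sums of its alternating series are \<open>O(k\<^sup>-\<^sup>2)\<close>, uniformly
  in their length.  Together with \<open>\<bar>(s - 2 choose k)\<bar> = O(k\<^sup>1\<^sup>-\<^sup>\<sigma>)\<close>, where \<open>\<sigma> = Re s\<close>, this gives the
  summable bound \<open>O(k\<^sup>-\<^sup>1\<^sup>-\<^sup>\<sigma>)\<close> for \<open>\<sigma> > 0\<close>, and Tannery's theorem applies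
  (\<open>newton_series_sums_eta\<close>).

  For the zeros, each symmetrized factorial is \<open>\<Prod>(a\<^sub>j - s) + \<Prod>(a\<^sub>j - (1 - s))\<close> with real
  \<open>a\<^sub>j > 1/2\<close>.  If \<open>Re s \<noteq> 1/2\<close>, one of \<open>s\<close> and \<open>1 - s\<close> is strictly closer to all the \<open>a\<^sub>j\<close> than the
  other, so the two products differ in modulus and cannot cancel
  (\<open>symmetrized_prod_zero_Re\<close>).
\<close>

section \<open>Alternating sums of unimodal sequences\<close>

text \<open>Summation by parts: twice an alternating sum is a telescoping sum of boundary values plus an
  alternating sum of differences, so the variation controls it.\<close>

lemma alternating_sum_variation:
  fixes f :: "nat \<Rightarrow> real"
  shows "\<bar>2 * (\<Sum>n<J. (-1) ^ n * f n) + (-1) ^ J * f J - f 0\<bar> \<le> (\<Sum>n<J. \<bar>f (Suc n) - f n\<bar>)"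
proof (induction J)
  case (Suc J)
  have step: "2 * (\<Sum>n<Suc J. (-1) ^ n * f n) + (-1) ^ Suc J * f (Suc J) - f 0
      = (2 * (\<Sum>n<J. (-1) ^ n * f n) + (-1) ^ J * f J - f 0) + (-1) ^ J * (f J - f (Suc J))"
    by (simp add: algebra_simps)
  have "\<bar>(-1) ^ J * (f J - f (Suc J))\<bar> = \<bar>f (Suc J) - f J\<bar>"
    by (simp add: abs_mult abs_minus_commute)
  then show ?case
    unfolding step using Suc unfolding sum.lessThan_Suc by linarith
qed simp

lemma unimodal_variation:
  fixes f :: "nat \<Rightarrow> real"
  assumes up: "\<And>n. n < N \<Longrightarrow> f n \<le> f (Suc n)" and down: "\<And>n. N \<le> n \<Longrightarrow> f (Suc n) \<le> f n"
  shows "(\<Sum>n<J. \<bar>f (Suc n) - f n\<bar>) = (if J \<le> N then f J - f 0 else 2 * f N - f 0 - f J)"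
proof (induction J)
  case (Suc J)
  consider "Suc J \<le> N" | "J = N" | "N < J" by linarith
  then show ?case
    by cases (use Suc up[of J] down[of J] in auto)
qed simp

lemma alternating_sum_unimodal_le:
  fixes f :: "nat \<Rightarrow> real"
  assumes up: "\<And>n. n < N \<Longrightarrow> f n \<le> f (Suc n)" and down: "\<And>n. N \<le> n \<Longrightarrow> f (Suc n) \<le> f n"
    and nonneg: "\<And>n. 0 \<le> f n" and le: "\<And>n. f n \<le> M"
  shows "\<bar>\<Sum>n<J. (-1) ^ n * f n\<bar> \<le> M"
proof -
  have "\<bar>(-1) ^ J * f J\<bar> \<le> f J"
    using nonneg[of J] by (simp add: abs_mult)
  moreover have "(\<Sum>n<J. \<bar>f (Suc n) - f n\<bar>) \<le> 2 * M - f 0 - f J"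
    using unimodal_variation[of N f J, OF up down] le[of N] le[of J] by auto
  ultimately show ?thesis
    using alternating_sum_variation[of f J] nonneg[of 0] by linarith
qed

section \<open>Differences of the eta function at the integers from 2\<close>

text \<open>With \<open>x = n + 1\<close> this is \<open>x\<^sup>-\<^sup>2 (1 - 1/x)\<^sup>k\<close>, which is \<open>(-1)\<^sup>k\<close> times the \<open>k\<close>-th forward
  difference of \<open>t \<mapsto> x\<^sup>-\<^sup>t\<close> at \<open>t = 2\<close>.\<close>

definition bump :: "nat \<Rightarrow> nat \<Rightarrow> real" where
  "bump k n = (real n / real (Suc n)) ^ k / (real (Suc n))\<^sup>2"

text \<open>These are the coefficients of the Newton series: \<open>(-1)\<^sup>k\<close> times the \<open>k\<close>-th forward difference of
  \<open>\<eta>\<close> at 2.\<close>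

definition alt_bump :: "nat \<Rightarrow> real" where
  "alt_bump k = (\<Sum>n. (-1) ^ n * bump k n)"

lemma bump_eq: "bump k n = (1 / real (Suc n))\<^sup>2 * (1 - 1 / real (Suc n)) ^ k"
proof -
  have "real n / real (Suc n) = 1 - 1 / real (Suc n)" by (simp add: field_simps)
  then show ?thesis by (simp add: bump_def power_divide)
qed

lemma bump_nonneg: "0 \<le> bump k n"
  by (simp add: bump_def)

text \<open>With \<open>y = k/(n + 1)\<close> the value is at most \<open>y\<^sup>2 exp(-y) / k\<^sup>2\<close>, and \<open>y\<^sup>2 exp(-y)\<close> is bounded.\<close>

lemma bump_le:
  assumes "0 < k"
  shows "bump k n \<le> 2 / (real k)\<^sup>2"
proof -
  define y where "y = real k / real (Suc n)"
  have "(1 - 1 / real (Suc n)) ^ k \<le> exp (- (1 / real (Suc n))) ^ k"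
    using exp_ge_add_one_self[of "- (1 / real (Suc n))"] by (intro power_mono) auto
  also have "\<dots> = exp (- y)"
    by (simp add: y_def flip: exp_of_nat_mult)
  finally have "bump k n \<le> (1 / real (Suc n))\<^sup>2 * exp (- y)"
    unfolding bump_eq by (intro mult_left_mono) auto
  also have "(1 / real (Suc n))\<^sup>2 = y\<^sup>2 / (real k)\<^sup>2"
    using assms by (simp add: y_def power_divide)
  also have "y\<^sup>2 / (real k)\<^sup>2 * exp (- y) = (y\<^sup>2 * exp (- y)) / (real k)\<^sup>2"
    by simp
  also have "\<dots> \<le> 2 / (real k)\<^sup>2"
  proof (rule divide_right_mono)
    have "0 \<le> y" by (simp add: y_def)
    then have "y\<^sup>2 \<le> 2 * exp y"
      using exp_lower_Taylor_quadratic[of y] by linarith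
    then show "y\<^sup>2 * exp (- y) \<le> 2"
      by (simp add: exp_minus field_simps)
  qed simp
  finally show ?thesis .
qed

text \<open>In the variable \<open>u = 1/(n + 1)\<close> this is the function \<open>u\<^sup>2 (1 - u)\<^sup>k\<close>, which increases up to
  \<open>u = 2/(k + 2)\<close> and decreases afterwards; \<open>n\<close> runs in the opposite direction.\<close>

lemma bump_unimodal:
  assumes "0 < k"
  obtains N where "\<And>n. n < N \<Longrightarrow> bump k n \<le> bump k (Suc n)"
    and "\<And>n. N \<le> n \<Longrightarrow> bump k (Suc n) \<le> bump k n"
proof -
  define g where "g u = u\<^sup>2 * (1 - u) ^ k" for u :: real
  define g' where "g' u = u * (1 - u) ^ (k - 1) * (2 - (real k + 2) * u)" for u :: real
  obtain p where p: "k = Suc p"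
    using assms by (cases k) auto
  have deriv: "(g has_real_derivative g' u) (at u)" for u
  proof -
    have "((\<lambda>u. (1 - u) ^ Suc p) has_real_derivative - (real (Suc p) * (1 - u) ^ p)) (at u)"
      by (auto intro!: derivative_eq_intros simp del: power_Suc)
    then have "((\<lambda>u. u\<^sup>2 * (1 - u) ^ Suc p) has_real_derivative
        u\<^sup>2 * - (real (Suc p) * (1 - u) ^ p) + 2 * u * (1 - u) ^ Suc p) (at u)"
      by (auto intro!: derivative_eq_intros simp del: power_Suc)
    moreover have "u\<^sup>2 * - (real (Suc p) * (1 - u) ^ p) + 2 * u * (1 - u) ^ Suc p = g' u"
      by (simp add: g'_def p power2_eq_square algebra_simps)
    ultimately show ?thesis
      unfolding g_def p by simp
  qed
  have bump_g: "bump k n = g (1 / real (Suc n))" for n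
    by (simp only: bump_eq g_def)
  have up: "bump k n \<le> bump k (Suc n)" if "2 * Suc n \<le> k" for n
    unfolding bump_g
  proof (rule DERIV_nonpos_imp_nonincreasing[of _ _ g])
    show "1 / real (Suc (Suc n)) \<le> 1 / real (Suc n)" by (simp add: field_simps)
  next
    fix u assume u: "1 / real (Suc (Suc n)) \<le> u" "u \<le> 1 / real (Suc n)"
    from that have "2 * real (Suc n) + 2 \<le> real k + 2"
      by linarith
    then have "2 \<le> (real k + 2) * (1 / real (Suc (Suc n)))"
      by (simp add: field_simps)
    also have "\<dots> \<le> (real k + 2) * u"
      using u by (intro mult_left_mono) auto
    finally have "2 - (real k + 2) * u \<le> 0" by simp
    moreover have "0 \<le> u" by (rule order_trans[OF _ u(1)]) simp
    moreover have "u \<le> 1" by (rule order_trans[OF u(2)]) simp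
    ultimately have "g' u \<le> 0"
      unfolding g'_def by (intro mult_nonneg_nonpos) auto
    with deriv show "\<exists>y. (g has_real_derivative y) (at u) \<and> y \<le> 0" by blast
  qed
  have down: "bump k (Suc n) \<le> bump k n" if "k \<le> 2 * n" for n
    unfolding bump_g
  proof (rule DERIV_nonneg_imp_nondecreasing[of _ _ g])
    show "1 / real (Suc (Suc n)) \<le> 1 / real (Suc n)" by (simp add: field_simps)
  next
    fix u assume u: "1 / real (Suc (Suc n)) \<le> u" "u \<le> 1 / real (Suc n)"
    have "(real k + 2) * u \<le> (real k + 2) * (1 / real (Suc n))"
      using u by (intro mult_left_mono) auto
    also have "\<dots> \<le> 2"
      using that by (simp add: field_simps)
    finally have "0 \<le> 2 - (real k + 2) * u" by simp
    moreover have "0 \<le> u" by (rule order_trans[OF _ u(1)]) simp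
    moreover have "u \<le> 1" by (rule order_trans[OF u(2)]) simp
    ultimately have "0 \<le> g' u"
      unfolding g'_def by (intro mult_nonneg_nonneg) auto
    with deriv show "\<exists>y. (g has_real_derivative y) (at u) \<and> 0 \<le> y" by blast
  qed
  \<comment> \<open>For odd \<open>k\<close> the maximum of \<open>g\<close> lies strictly between two sample points, and the direction of the
    step from \<open>k div 2\<close> decides which of them is the peak.\<close>
  define h where "h = k div 2"
  have up': "bump k n \<le> bump k (Suc n)" if "n < h" for n
    using that by (intro up) (simp add: h_def; linarith)
  have down': "bump k (Suc n) \<le> bump k n" if "h < n" for n
    using that by (intro down) (simp add: h_def; linarith)
  show thesis
  proof (cases "bump k h \<le> bump k (Suc h)")
    case True
    show thesis
    proof (rule that[of "Suc h"])
      show "bump k n \<le> bump k (Suc n)" if "n < Suc h" for n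
        using True up'[of n] that by (cases "n = h") auto
    qed (use down' in auto)
  next
    case False
    show thesis
    proof (rule that[of h])
      show "bump k (Suc n) \<le> bump k n" if "h \<le> n" for n
        using False down'[of n] that by (cases "n = h") auto
    qed (use up' in auto)
  qed
qed

lemma alternating_bump_sum_le:
  assumes "0 < k"
  shows "\<bar>\<Sum>n<J. (-1) ^ n * bump k n\<bar> \<le> 2 / (real k)\<^sup>2"
proof -
  obtain N where "\<And>n. n < N \<Longrightarrow> bump k n \<le> bump k (Suc n)"
    and "\<And>n. N \<le> n \<Longrightarrow> bump k (Suc n) \<le> bump k n"
    using bump_unimodal[OF assms] by blast
  then show ?thesis
    using bump_nonneg bump_le[OF assms] by (rule alternating_sum_unimodal_le)
qed

lemma alt_bump_sums: "(\<lambda>n. (-1) ^ n * bump k n) sums alt_bump k"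
  unfolding alt_bump_def
proof (rule summable_sums, rule summable_comparison_test)
  show "summable (\<lambda>n. 1 / (real (Suc n))\<^sup>2)"
    using inverse_power_summable[of 2, where ?'a = real]
    by (subst summable_Suc_iff) (simp add: field_simps)
  have "bump k n \<le> 1 / (real (Suc n))\<^sup>2" for n
    unfolding bump_def by (intro divide_right_mono power_le_one) auto
  then show "\<exists>N. \<forall>n\<ge>N. norm ((-1) ^ n * bump k n) \<le> 1 / (real (Suc n))\<^sup>2"
    using bump_nonneg[of k] by (auto simp: abs_mult)
qed

lemma chi_eq_alt_bump:
  assumes "0 < m"
  shows "chi (m + 1) = real (m + 1) * alt_bump m"
proof -
  have "(\<lambda>n. (-1) ^ Suc n * bump m (Suc n)) sums alt_bump m"
    using alt_bump_sums[of m] assms by (subst sums_Suc_iff) (simp add: bump_def[of m 0] zero_power)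
  then have "(\<lambda>n. real (m + 1) * ((-1) ^ Suc n * bump m (Suc n))) sums (real (m + 1) * alt_bump m)"
    by (rule sums_mult)
  moreover have "real (m + 1) * ((-1) ^ Suc n * bump m (Suc n)) =
      (-1) ^ (n + 1) * (real (m + 1) / real (n + 2) ^ 2) * (1 - 1 / real (n + 2)) ^ (m + 1 - 1)" for n
    unfolding bump_eq by (simp add: power_divide)
  ultimately show ?thesis
    unfolding chi_def by (simp only: sums_iff)
qed

text \<open>Expand \<open>x\<^sup>-\<^sup>l = (1 - (1 - 1/x))\<^sup>l\<close> by the binomial theorem.  The finite Newton expansion
  is exact at the nodes, and that is what makes the Newton polynomial below interpolate \<open>\<eta>\<close>.\<close>

lemma eta_nat_sums:
  "(\<lambda>n. (-1) ^ n * (1 / real (Suc n) ^ (l + 2))) sums (\<Sum>k\<le>l. (-1) ^ k * real (l choose k) * alt_bump k)"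
proof -
  have "(\<lambda>n. \<Sum>k\<le>l. (-1) ^ k * real (l choose k) * ((-1) ^ n * bump k n))
     sums (\<Sum>k\<le>l. (-1) ^ k * real (l choose k) * alt_bump k)"
    by (intro sums_sum sums_mult alt_bump_sums)
  moreover have "(\<Sum>k\<le>l. (-1) ^ k * real (l choose k) * ((-1) ^ n * bump k n)) =
      (-1) ^ n * (1 / real (Suc n) ^ (l + 2))" for n
  proof -
    define z where "z = real n / real (Suc n)"
    have z: "1 / real (Suc n) = - z + 1"
      by (simp add: z_def field_simps)
    have "(1 / real (Suc n)) ^ l = (\<Sum>k\<le>l. real (l choose k) * (- z) ^ k)"
      unfolding z binomial_ring by simp
    moreover have "1 / real (Suc n) ^ (l + 2) = 1 / (real (Suc n))\<^sup>2 * (1 / real (Suc n)) ^ l"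
      by (simp only: power_add power_one_over) simp
    ultimately have "(-1) ^ n * (1 / real (Suc n) ^ (l + 2)) =
        (\<Sum>k\<le>l. (-1) ^ n / (real (Suc n))\<^sup>2 * (real (l choose k) * (- z) ^ k))"
      by (subst sum_distrib_left[symmetric]) simp
    also have "\<dots> = (\<Sum>k\<le>l. (-1) ^ k * real (l choose k) * ((-1) ^ n * bump k n))"
      by (intro sum.cong refl) (simp add: bump_def z_def power_minus[of "real n / real (Suc n)"] del: of_nat_Suc)
    finally show ?thesis by (rule sym)
  qed
  ultimately show ?thesis by (simp only:)
qed

lemma eta_nat_powr:
  "(-1) ^ n * of_nat (Suc n) powr (- real (l + 2)) = (-1) ^ n * (1 / real (Suc n) ^ (l + 2))"
  by (subst powr_minus, subst powr_realpow) (simp_all add: divide_inverse)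

lemma eta_nat_eq:
  "dirichlet_eta (real (l + 2)) = (\<Sum>k\<le>l. (-1) ^ k * real (l choose k) * alt_bump k)"
  unfolding dirichlet_eta_def eta_nat_powr using eta_nat_sums[of l] by (rule sums_unique[symmetric])

lemma eta_nat_bounds:
  "0 < dirichlet_eta (real (l + 2))" "dirichlet_eta (real (l + 2)) < 1"
proof -
  define a where "a n = 1 / real (Suc n) ^ (l + 2)" for n
  have eta: "dirichlet_eta (real (l + 2)) = (\<Sum>n. (-1) ^ n * a n)"
    unfolding dirichlet_eta_def eta_nat_powr a_def ..
  have strict: "a (Suc n) < a n" for n
    unfolding a_def by (intro divide_strict_left_mono power_strict_mono) auto
  have "a \<longlonglongrightarrow> 0"
  proof (rule tendsto_sandwich[of "\<lambda>_. 0" a _ "\<lambda>n. 1 / real (Suc n)"])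
    show "(\<lambda>n. 1 / real (Suc n)) \<longlonglongrightarrow> 0"
      using LIMSEQ_inverse_real_of_nat by (simp add: inverse_eq_divide)
    have "a n \<le> 1 / real (Suc n)" for n
      unfolding a_def using power_increasing[of 1 "l + 2" "real (Suc n)"]
      by (intro divide_left_mono) auto
    then show "\<forall>\<^sub>F n in sequentially. a n \<le> 1 / real (Suc n)" by simp
  qed (auto simp: a_def)
  moreover have "0 \<le> a n" "a (Suc n) \<le> a n" for n
    using strict[of n] by (auto simp: a_def)
  ultimately have leibniz: "(\<Sum>i<2 * n. (-1) ^ i * a i) \<le> (\<Sum>i. (-1) ^ i * a i)"
      "(\<Sum>i. (-1) ^ i * a i) \<le> (\<Sum>i<2 * n + 1. (-1) ^ i * a i)" for n
    using summable_Leibniz'(2,4)[of a n] by blast+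
  have "a 0 = 1" by (simp add: a_def)
  then show "0 < dirichlet_eta (real (l + 2))" "dirichlet_eta (real (l + 2)) < 1"
    using leibniz(1)[of 1] leibniz(2)[of 1] strict[of 0] strict[of 1]
    unfolding eta by (auto simp: numeral_eq_Suc)
qed

section \<open>The Newton series of the eta function\<close>

text \<open>Binomial series for \<open>x\<^sup>2\<^sup>-\<^sup>s\<close> in powers of \<open>1 - 1/x\<close>, divided by \<open>x\<^sup>2\<close>, where \<open>x = n + 1\<close>.\<close>

lemma newton_term_sums:
  fixes s :: complex
  shows "(\<lambda>k. (s - 2 gchoose k) * (-1) ^ k * of_real (bump k n)) sums (of_nat (Suc n) powr (- s))"
proof -
  define z where "z = real n / real (Suc n)"
  define c where "c = real (Suc n)"
  have c: "0 < c" by (simp add: c_def)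
  have "norm (- complex_of_real z) < 1"
    by (simp add: z_def norm_divide del: of_nat_Suc)
  then have "(\<lambda>k. (s - 2 gchoose k) * (- of_real z) ^ k) sums (1 + - of_real z) powr (s - 2)"
    by (rule gen_binomial_complex)
  moreover have "1 + - complex_of_real z = of_real (1 / c)"
  proof -
    have "1 / c = 1 - z" by (simp add: z_def c_def field_simps)
    then show ?thesis by (simp only: of_real_diff of_real_1 add_uminus_conv_diff)
  qed
  moreover have "of_real (1 / c) powr (s - 2) = of_real c powr (2 - s)"
    using c by (simp add: powr_def Ln_of_real ln_div algebra_simps flip: of_real_inverse of_real_divide)
  ultimately have "(\<lambda>k. (s - 2 gchoose k) * (- of_real z) ^ k) sums (of_real c powr (2 - s))"
    by (simp only:)
  then have "(\<lambda>k. of_real (1 / c\<^sup>2) * ((s - 2 gchoose k) * (- of_real z) ^ k))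
      sums (of_real (1 / c\<^sup>2) * of_real c powr (2 - s))"
    by (rule sums_mult)
  moreover have "of_real (1 / c\<^sup>2) * of_real c powr (2 - s) = complex_of_real c powr (- s)"
    using c by (simp add: powr_diff powr_minus field_simps)
  moreover have "of_real (1 / c\<^sup>2) * ((s - 2 gchoose k) * (- of_real z) ^ k) =
      (s - 2 gchoose k) * (-1) ^ k * of_real (bump k n)" for k
  proof -
    have "bump k n = z ^ k / c\<^sup>2"
      by (simp only: bump_def z_def c_def)
    then show ?thesis
      by (simp add: power_minus[of "complex_of_real z"])
  qed
  ultimately show ?thesis
    by (simp only: c_def of_real_of_nat_eq)
qed

lemma gbinomial_bound:
  fixes z :: complex
  obtains K where "0 \<le> K" "\<And>k. 0 < k \<Longrightarrow> norm (z gchoose k) \<le> K * real k powr (- (Re z + 1))"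
proof -
  have "Bseq (\<lambda>n. (z gchoose n) / ((-1)^n / exp ((z+1) * of_real (ln (real n)))))"
    using gbinomial_asymptotic[of z] by (intro convergent_imp_Bseq convergentI)
  then obtain K where K: "0 < K"
      "\<And>n. norm ((z gchoose n) / ((-1)^n / exp ((z+1) * of_real (ln (real n))))) \<le> K"
    by (auto elim: BseqE)
  show thesis
  proof (rule that)
    fix k :: nat assume "0 < k"
    have w: "norm ((-1) ^ k / exp ((z+1) * of_real (ln (real k)))) = real k powr (- (Re z + 1))"
      using \<open>0 < k\<close> by (simp add: norm_divide norm_power powr_def algebra_simps flip: exp_minus divide_inverse inverse_eq_divide)
    have "norm (z gchoose k) = norm ((z gchoose k) / ((-1)^k / exp ((z+1) * of_real (ln (real k))))) *
        real k powr (- (Re z + 1))"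
      unfolding norm_divide[of "z gchoose k"] w using \<open>0 < k\<close> by simp
    also have "\<dots> \<le> K * real k powr (- (Re z + 1))"
      by (intro mult_right_mono K) auto
    finally show "norm (z gchoose k) \<le> K * real k powr (- (Re z + 1))" .
  qed (use K in auto)
qed

text \<open>For \<open>0 < Re s \<le> 1\<close> the double series over \<open>k\<close> and \<open>n\<close> is not absolutely convergent.  So Tannery's theorem is applied
  to the partial sums over \<open>n\<close>, whose bound \<open>2/k\<^sup>2\<close> does not depend on their length.\<close>

lemma newton_series_sums_eta:
  fixes s :: complex
  assumes "0 < Re s"
  shows "(\<lambda>k. (s - 2 gchoose k) * (-1) ^ k * of_real (alt_bump k)) sums dirichlet_eta s"
proof -
  define c where "c k = (s - 2 gchoose k) * (-1) ^ k" for k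
  define S where "S k J = (\<Sum>n<J. (-1) ^ n * bump k n)" for k J
  obtain K where K: "0 \<le> K"
      "\<And>k. 0 < k \<Longrightarrow> norm (s - 2 gchoose k) \<le> K * real k powr (- (Re (s - 2) + 1))"
    using gbinomial_bound[of "s - 2"] by blast
  define M where "M k = 2 * K * real k powr (- 1 - Re s)" for k
  have "summable M"
    unfolding M_def using assms by (intro summable_mult) (simp add: summable_real_powr_iff)
  have bound: "norm (c k * of_real (S k J)) \<le> M k" if "0 < k" for k J
  proof -
    have "norm (c k * of_real (S k J)) = norm (s - 2 gchoose k) * \<bar>S k J\<bar>"
      by (simp add: c_def norm_mult norm_power)
    also have "\<dots> \<le> K * real k powr (- (Re (s - 2) + 1)) * (2 / (real k)\<^sup>2)"
      unfolding S_def using K that alternating_bump_sum_le[OF that, of J]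
      by (intro mult_mono) auto
    also have "\<dots> = 2 * K * (real k powr (1 - Re s) / real k powr 2)"
      using that by simp
    also have "\<dots> = M k"
      by (simp only: M_def powr_diff[symmetric]) (simp add: algebra_simps )
    finally show ?thesis .
  qed
  have "eventually (\<lambda>(k, J). norm (c k * of_real (S k J)) \<le> M k) (at_top \<times>\<^sub>F at_top)"
    unfolding eventually_prod_filter
    by (rule exI[of _ "\<lambda>k. 0 < k"], rule exI[of _ "\<lambda>_. True"]) (auto simp: bound eventually_gt_at_top)
  moreover have "(\<lambda>J. c k * of_real (S k J)) \<longlonglongrightarrow> c k * of_real (alt_bump k)" for k
    unfolding S_def using alt_bump_sums[of k, unfolded sums_def]
    by (intro tendsto_intros)
  ultimately have tannery: "summable (\<lambda>k. norm (c k * of_real (alt_bump k)))"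
      "(\<lambda>J. \<Sum>k. c k * of_real (S k J)) \<longlonglongrightarrow> (\<Sum>k. c k * of_real (alt_bump k))"
    using tannerys_theorem[of "\<lambda>k J. c k * of_real (S k J)" "\<lambda>k. c k * of_real (alt_bump k)"
        sequentially M] \<open>summable M\<close> by auto
  have "(\<lambda>k. c k * of_real (S k J)) sums (\<Sum>n<J. (-1) ^ n * of_nat (Suc n) powr (- s))" for J
  proof -
    have "(\<lambda>k. \<Sum>n<J. (-1) ^ n * (c k * of_real (bump k n)))
        sums (\<Sum>n<J. (-1) ^ n * of_nat (Suc n) powr (- s))"
      unfolding c_def by (intro sums_sum sums_mult newton_term_sums)
    then show ?thesis
      by (simp add: S_def sum_distrib_left mult_ac)
  qed
  then have "(\<lambda>J. \<Sum>n<J. (-1) ^ n * of_nat (Suc n) powr (- s)) \<longlonglongrightarrow> (\<Sum>k. c k * of_real (alt_bump k))"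
    using tannery(2) by (simp add: sums_iff)
  then have "(\<lambda>n. (-1) ^ n * of_nat (Suc n) powr (- s)) sums (\<Sum>k. c k * of_real (alt_bump k))"
    by (simp add: sums_def)
  then have "dirichlet_eta s = (\<Sum>k. c k * of_real (alt_bump k))"
    by (simp add: dirichlet_eta_def sums_iff)
  then show ?thesis
    using tannery(1) unfolding c_def by (simp add: summable_norm_cancel summable_sums)
qed

section \<open>Products over the nodes\<close>

lemma linear_prod_degree_coeff:
  fixes a :: "'i \<Rightarrow> 'a :: comm_ring_1"
  assumes "finite A"
  shows "degree (\<Prod>i\<in>A. [:a i, b:]) \<le> card A \<and> coeff (\<Prod>i\<in>A. [:a i, b:]) (card A) = b ^ card A"
  using assms
proof (induction A rule: finite_induct)
  case (insert x A)
  define p where "p = (\<Prod>i\<in>A. [:a i, b:])"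
  have prod: "(\<Prod>i\<in>insert x A. [:a i, b:]) = smult (a x) p + pCons 0 (smult b p)"
    using insert by (simp add: p_def)
  have IH: "degree p \<le> card A" "coeff p (card A) = b ^ card A"
    using insert by (auto simp: p_def)
  have "degree (smult (a x) p + pCons 0 (smult b p)) \<le> Suc (card A)"
    using IH(1) degree_smult_le[of "a x" p] degree_smult_le[of b p]
      degree_pCons_le[of 0 "smult b p"] by (intro degree_add_le) linarith+
  moreover have "coeff p (Suc (card A)) = 0"
    using IH(1) by (intro coeff_eq_0) simp
  ultimately show ?case
    unfolding prod using insert IH(2) by simp
qed simp

lemma poly_eq_linear_prod:
  fixes p :: "'a :: idom poly"
  assumes "degree p \<le> m" and root: "\<And>j. j < m \<Longrightarrow> poly p (a j) = 0" and "inj_on a {..<m}"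
  shows "smult ((-1) ^ m) p = smult (coeff p m) (\<Prod>j<m. [:a j, -1:])"
proof -
  note lin = linear_prod_degree_coeff[of "{..<m}" a "-1"]
  show ?thesis
  proof (rule poly_eqI_degree_lead_coeff[of _ m _ "a ` {..<m}"])
    show "coeff (smult ((-1) ^ m) p) m = coeff (smult (coeff p m) (\<Prod>j<m. [:a j, -1:])) m"
      using lin by simp
    show "degree (smult ((-1) ^ m) p) \<le> m"
      using assms(1) degree_smult_le order_trans by blast
    show "degree (smult (coeff p m) (\<Prod>j<m. [:a j, -1:])) \<le> m"
      using lin degree_smult_le[of "coeff p m"] order_trans by fastforce
    show "m \<le> card (a ` {..<m})"
      using assms(3) by (simp add: card_image)
  qed (auto simp: root poly_prod)
qed

lemma prod_node_differences:
  assumes "l \<le> m"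
  shows "(\<Prod>j\<in>{..m} - {l}. real j - real l) = (-1) ^ l * fact l * fact (m - l)"
  using assms
proof (induction m rule: dec_induct)
  case base
  have "(\<Prod>j\<in>{..l} - {l}. real j - real l) = (\<Prod>j<l. - real (l - j))"
    by (intro prod.cong) auto
  also have "\<dots> = (-1) ^ l * (\<Prod>j<l. real (l - j))"
    by (subst prod_uminus) simp
  also have "(\<Prod>j<l. real (l - j)) = fact l"
    by (simp only: fact_prod_rev atLeast0LessThan of_nat_prod)
  finally show ?case by simp
next
  case (step m)
  have "{..Suc m} - {l} = insert (Suc m) ({..m} - {l})"
    using step by auto
  then show ?case
    using step by (simp add: Suc_diff_le)
qed

text \<open>The left-hand side is a product of \<open>l\<close> negative and \<open>m - l\<close> positive half-integers, both
  expressed by \<open>\<Gamma>\<close>; the factor \<open>\<pi>\<close> comes from \<open>\<Gamma>(1/2)\<^sup>2\<close>.  This matches the Gamma summand of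
  \<open>\<epsilon>\<^sub>l\<close> with the polynomial \<open>\<Prod>(j + 5/2 - s)\<close> at \<open>s = l + 2\<close>.\<close>

lemma prod_half_node_differences:
  assumes "l \<le> m"
  shows "pi * (\<Prod>j<m. real j + 1/2 - real l) = (-1) ^ l * Gamma (real l + 1/2) * Gamma (real m - real l + 1/2)"
  using assms
proof (induction m rule: dec_induct)
  case base
  have "(\<Prod>j<l. real j + 1/2 - real l) = (\<Prod>j<l. - (1/2 + real j))"
    by (subst prod.nat_diff_reindex[symmetric]) (intro prod.cong, auto)
  also have "\<dots> = (-1) ^ l * pochhammer (1/2) l"
    by (subst prod_uminus) (simp add: pochhammer_prod atLeast0LessThan)
  also have "pochhammer (1/2) l = Gamma (real l + 1/2) / sqrt pi"
    by (subst pochhammer_Gamma) (auto simp: Gamma_one_half_real add.commute elim!: nonpos_Ints_cases')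
  finally show ?case
    by (simp add: Gamma_one_half_real divide_eq_eq)
next
  case (step m)
  have "real (Suc m) - real l + 1/2 = (real m - real l + 1/2) + 1"
    by simp
  moreover have "Gamma ((real m - real l + 1/2) + 1) = (real m - real l + 1/2) * Gamma (real m - real l + 1/2)"
    using step by (intro Gamma_plus1) (auto elim!: nonpos_Ints_cases')
  ultimately have Gamma_Suc: "Gamma (real (Suc m) - real l + 1/2) =
      (real m - real l + 1/2) * Gamma (real m - real l + 1/2)"
    by (simp only:)
  have "pi * (\<Prod>j<Suc m. real j + 1/2 - real l) =
      (real m - real l + 1/2) * (pi * (\<Prod>j<m. real j + 1/2 - real l))"
    by simp
  also have "\<dots> = (-1) ^ l * Gamma (real l + 1/2) * Gamma (real (Suc m) - real l + 1/2)"
    unfolding step.IH Gamma_Suc by simp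
  finally show ?case .
qed

text \<open>The midpoint case of log-convexity.\<close>

lemma Gamma_midpoint_le:
  assumes "0 < x" "0 < y"
  shows "(Gamma ((x + y) / 2))\<^sup>2 \<le> Gamma x * Gamma (y :: real)"
proof -
  have "(ln \<circ> Gamma) ((1 - 1/2) *\<^sub>R x + (1/2) *\<^sub>R y) \<le> (1 - 1/2) * (ln \<circ> Gamma) x + (1/2) * (ln \<circ> Gamma) y"
    using assms by (intro convex_onD[OF log_convex_Gamma_real]) auto
  moreover have "(1 - 1/2) *\<^sub>R x + (1/2) *\<^sub>R y = (x + y) / 2"
    by (simp add: field_simps)
  ultimately have "2 * ln (Gamma ((x + y) / 2)) \<le> ln (Gamma x) + ln (Gamma y)"
    by (simp only: comp_def) simp
  moreover have "0 < Gamma x" "0 < Gamma y" "0 < Gamma ((x + y) / 2)"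
    using assms by (auto intro!: Gamma_real_pos)
  ultimately have "ln ((Gamma ((x + y) / 2))\<^sup>2) \<le> ln (Gamma x * Gamma y)"
    by (simp add: ln_mult ln_realpow)
  then show ?thesis
    using \<open>0 < Gamma x\<close> \<open>0 < Gamma y\<close> \<open>0 < Gamma ((x + y) / 2)\<close> by (subst (asm) ln_le_cancel_iff) auto
qed

text \<open>The quotient of Gamma values is at least 1 by log-convexity, and it outweighs the possibly
  negative summand because \<open>0 < \<eta> < 1\<close> at the nodes.\<close>

lemma eps_pos:
  assumes "l \<le> m"
  shows "0 < eps m l"
proof -
  define G where "G = gfact ((real m - 1) / 2)"
  have G: "0 < G" unfolding G_def gfact_def by (intro Gamma_real_pos) (simp add: field_simps add_pos_nonneg)
  have "(real l + 1/2 + (real m - real l + 1/2)) / 2 = (real m - 1) / 2 + 1"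
    by (simp add: field_simps)
  then have "G\<^sup>2 \<le> Gamma (real l + 1/2) * Gamma (real m - real l + 1/2)"
    using Gamma_midpoint_le[of "real l + 1/2" "real m - real l + 1/2"] assms
    by (simp only: G_def gfact_def)
  then have "1 \<le> gfact (real l - 1/2) * gfact (real m - real l - 1/2) / G\<^sup>2"
    using G by (simp add: gfact_def algebra_simps)
  moreover have "-1 < (-1) ^ l * dirichlet_eta (real (l + 2))"
    using eta_nat_bounds[of l] by (cases "even l") auto
  ultimately show ?thesis
    unfolding eps_def G_def[symmetric] by (intro mult_pos_pos) auto
qed

section \<open>The interpolating polynomials\<close>

definition half_coeff :: "nat \<Rightarrow> real" where
  "half_coeff m = pi / (gfact ((real m - 1) / 2))\<^sup>2"

definition newton_poly :: "nat \<Rightarrow> complex poly" where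
  "newton_poly m = (\<Sum>k\<le>m. smult ((-1) ^ k * of_real (alt_bump k) / fact k) (\<Prod>i<k. [:- of_nat i - 2, 1:]))"

definition half_poly :: "nat \<Rightarrow> complex poly" where
  "half_poly m = smult (of_real (half_coeff m)) (\<Prod>j<m. [:of_nat j + 5/2, -1:])"

lemma poly_newton_poly:
  "poly (newton_poly m) s = (\<Sum>k\<le>m. (s - 2 gchoose k) * (-1) ^ k * of_real (alt_bump k))"
  unfolding newton_poly_def poly_sum poly_smult poly_prod gbinomial_prod_rev
  by (intro sum.cong refl) (simp add: atLeast0LessThan algebra_simps)

lemma poly_newton_poly_node:
  assumes "l \<le> m"
  shows "poly (newton_poly m) (of_nat l + 2) = of_real (dirichlet_eta (real (l + 2)))"
proof -
  have "poly (newton_poly m) (of_nat l + 2) = (\<Sum>k\<le>m. of_real ((-1) ^ k * real (l choose k) * alt_bump k))"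
    unfolding poly_newton_poly by (intro sum.cong refl) (simp add: binomial_gbinomial[symmetric])
  also have "\<dots> = (\<Sum>k\<le>l. of_real ((-1) ^ k * real (l choose k) * alt_bump k))"
    using assms by (intro sum.mono_neutral_right) auto
  finally show ?thesis
    unfolding eta_nat_eq by simp
qed

lemma poly_half_poly:
  "poly (half_poly m) s = of_real (half_coeff m) * (\<Prod>j<m. of_nat j + 5/2 - s)"
  by (simp add: half_poly_def poly_prod)

lemma poly_half_poly_node:
  assumes "l \<le> m"
  shows "poly (half_poly m) (of_nat l + 2) =
    of_real ((-1) ^ l * gfact (real l - 1/2) * gfact (real m - real l - 1/2) / (gfact ((real m - 1) / 2))\<^sup>2)"
proof -
  have "(\<Prod>j<m. of_nat j + 5/2 - (of_nat l + 2 :: complex)) = of_real (\<Prod>j<m. real j + 1/2 - real l)"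
    unfolding of_real_prod by (intro prod.cong refl) simp
  moreover have "real l - 1/2 + 1 = real l + 1/2" "real m - real l - 1/2 + 1 = real m - real l + 1/2"
    by simp_all
  then have "pi * (\<Prod>j<m. real j + 1/2 - real l) = (-1) ^ l * gfact (real l - 1/2) * gfact (real m - real l - 1/2)"
    unfolding prod_half_node_differences[OF assms] gfact_def by (simp only:)
  ultimately show ?thesis
    unfolding poly_half_poly half_coeff_def by (simp only: of_real_mult[symmetric] times_divide_eq_left)
qed

lemma eps_poly_node:
  assumes "l \<le> m"
  shows "eps_poly m (real l + 2) = (-1) ^ l * fact l * fact (m - l) * eps m l"
proof -
  have "eps_poly m (real l + 2) = (\<Sum>k\<in>{l}. eps m k * (\<Prod>j\<in>{..m} - {k}. real j + 2 - (real l + 2)))"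
    unfolding eps_poly_def using assms by (intro sum.mono_neutral_right) auto
  also have "\<dots> = eps m l * (\<Prod>j\<in>{..m} - {l}. real j - real l)"
    by simp
  finally show ?thesis
    unfolding prod_node_differences[OF assms] by simp
qed

lemma degree_newton_poly: "degree (newton_poly m) \<le> m"
  unfolding newton_poly_def
proof (intro degree_sum_le)
  fix k assume k: "k \<in> {..m}"
  have "degree (\<Prod>i<k. [:- of_nat i - 2, 1 :: complex:]) \<le> k"
    using linear_prod_degree_coeff[of "{..<k}" "\<lambda>i. - of_nat i - 2 :: complex" 1] by simp
  with k show "degree (smult ((-1) ^ k * of_real (alt_bump k) / fact k)
      (\<Prod>i<k. [:- of_nat i - 2, 1 :: complex:])) \<le> m"
    using degree_smult_le order_trans by fastforce
qed simp

lemma coeff_newton_poly: "coeff (newton_poly m) m = (-1) ^ m * of_real (alt_bump m) / fact m"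
proof -
  have lin: "degree (\<Prod>i<k. [:- of_nat i - 2, 1 :: complex:]) \<le> k"
      "coeff (\<Prod>i<k. [:- of_nat i - 2, 1 :: complex:]) k = 1" for k
    using linear_prod_degree_coeff[of "{..<k}" "\<lambda>i. - of_nat i - 2 :: complex" 1] by auto
  have "coeff (newton_poly m) m = (\<Sum>k\<in>{m}. (-1) ^ k * of_real (alt_bump k) / fact k *
      coeff (\<Prod>i<k. [:- of_nat i - 2, 1 :: complex:]) m)"
    unfolding newton_poly_def coeff_sum coeff_smult
    by (intro sum.mono_neutral_right) (auto intro!: coeff_eq_0 le_less_trans[OF lin(1)])
  then show ?thesis using lin(2)[of m] by simp
qed

lemma degree_half_poly: "degree (half_poly m) \<le> m"
  and coeff_half_poly: "coeff (half_poly m) m = (-1) ^ m * of_real (half_coeff m)"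
proof -
  have lin: "degree (\<Prod>j<m. [:of_nat j + 5/2, - 1 :: complex:]) \<le> m"
      "coeff (\<Prod>j<m. [:of_nat j + 5/2, - 1 :: complex:]) m = (-1) ^ m"
    using linear_prod_degree_coeff[of "{..<m}" "\<lambda>j. of_nat j + 5/2 :: complex" "-1"] by auto
  show "degree (half_poly m) \<le> m"
    unfolding half_poly_def using lin(1) degree_smult_le order_trans by blast
  show "coeff (half_poly m) m = (-1) ^ m * of_real (half_coeff m)"
    by (simp add: half_poly_def lin(2))
qed

text \<open>Both sides have degree at most \<open>m\<close> and agree at the \<open>m + 1\<close> nodes \<open>2, \<dots>, m + 2\<close>.\<close>

lemma eps_poly_eq_interpolation:
  "of_real (eps_poly m x) = poly (newton_poly m + half_poly m) (of_real x)"
proof -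
  define E where "E = (\<Sum>k\<le>m. smult (complex_of_real (eps m k)) (\<Prod>j\<in>{..m} - {k}. [:of_nat j + 2, -1:]))"
  have poly_E: "poly E (of_real x) = of_real (eps_poly m x)" for x
    by (simp add: E_def eps_poly_def poly_sum poly_prod)
  define A where "A = (\<lambda>l. of_nat l + 2 :: complex) ` {..m}"
  have "E = newton_poly m + half_poly m"
  proof (rule poly_eqI_degree[of A])
    fix z assume "z \<in> A"
    then obtain l where l: "l \<le> m" "z = of_nat l + 2" by (auto simp: A_def)
    have "poly E z = of_real (eps_poly m (real l + 2))"
      using poly_E[of "real l + 2"] l by simp
    also have "eps_poly m (real l + 2) = dirichlet_eta (real (l + 2)) +
        (-1) ^ l * gfact (real l - 1/2) * gfact (real m - real l - 1/2) / (gfact ((real m - 1) / 2))\<^sup>2"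
    proof -
      have "(-1) ^ l * ((-1) ^ l * x) = x" for x :: real
        by (simp flip: mult.assoc power_add)
      then show ?thesis
        unfolding eps_poly_node[OF l(1)] eps_def by (simp add: distrib_left)
    qed
    finally show "poly E z = poly (newton_poly m + half_poly m) z"
      unfolding l(2) poly_add poly_newton_poly_node[OF l(1)] poly_half_poly_node[OF l(1)] by simp
  next
    have card: "card A = Suc m"
      unfolding A_def by (subst card_image) (auto simp: inj_on_def)
    have "degree E \<le> m"
      unfolding E_def
    proof (intro degree_sum_le)
      fix k assume "k \<in> {..m}"
      then have "degree (\<Prod>j\<in>{..m} - {k}. [:of_nat j + 2, - 1 :: complex:]) \<le> m"
        using linear_prod_degree_coeff[of "{..m} - {k}" "\<lambda>j. of_nat j + 2 :: complex" "-1"] by simp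
      then show "degree (smult (complex_of_real (eps m k)) (\<Prod>j\<in>{..m} - {k}. [:of_nat j + 2, -1:])) \<le> m"
        using degree_smult_le order_trans by blast
    qed simp
    then show "degree E < card A" using card by simp
    have "degree (newton_poly m + half_poly m) \<le> m"
      by (intro degree_add_le degree_newton_poly degree_half_poly)
    then show "degree (newton_poly m + half_poly m) < card A" using card by simp
  qed
  then show ?thesis using poly_E by simp
qed

text \<open>At the node \<open>l + 2\<close> the value has the sign \<open>(-1)\<^sup>l\<close>, since \<open>\<epsilon>\<^sub>l > 0\<close>, so the intermediate value
  theorem gives a zero between any two neighbouring nodes.\<close>

lemma eps_poly_root_exists:
  assumes "j < m"
  shows "\<exists>d. 0 < d \<and> d < 1 \<and> eps_poly m (real j + 2 + d) = 0"
proof -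
  define f where "f x = (-1) ^ j * eps_poly m x" for x
  have cont: "continuous_on S f" for S
    unfolding f_def eps_poly_def by (intro continuous_intros)
  have "f (real j + 2) = fact j * fact (m - j) * eps m j"
    using assms unfolding f_def by (subst eps_poly_node) (simp_all flip: mult.assoc power_add)
  then have pos: "0 < f (real j + 2)"
    using eps_pos[of j m] assms by simp
  have "real (Suc j) + 2 = real j + 3" by simp
  then have "eps_poly m (real j + 3) = (-1) ^ Suc j * fact (Suc j) * fact (m - Suc j) * eps m (Suc j)"
    using eps_poly_node[of "Suc j" m] assms by (simp only: Suc_leI)
  then have "f (real j + 3) = - (fact (Suc j) * fact (m - Suc j) * eps m (Suc j))"
    unfolding f_def by (cases "even j") (simp_all del: fact_Suc)
  then have neg: "f (real j + 3) < 0"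
    using eps_pos[of "Suc j" m] assms by simp
  obtain x where x: "real j + 2 \<le> x" "x \<le> real j + 3" "f x = 0"
    using IVT2'[of f "real j + 3" 0 "real j + 2"] pos neg cont by auto
  have "x \<noteq> real j + 2" "x \<noteq> real j + 3"
    using pos neg x(3) by auto
  then show ?thesis
    using x by (intro exI[of _ "x - real j - 2"]) (auto simp: f_def)
qed

definition node :: "nat \<Rightarrow> nat \<Rightarrow> real" where
  "node m j = real j + 2 + dshift m j"

text \<open>One zero from each of the \<open>m\<close> gaps already exhausts the degree.  So the chosen zeros give the
  complete factorization, and no gap contains a second zero: this makes the descriptions in
  \<open>dshift\<close> well-defined.\<close>

lemma dshift_props:
  assumes "even m"
  shows "\<And>j. j < m \<Longrightarrow> 0 < dshift m j \<and> dshift m j < 1"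
    and "newton_poly m + half_poly m =
      smult (of_real (alt_bump m / fact m + half_coeff m)) (\<Prod>j<m. [:of_real (node m j), -1:])"
proof -
  define P where "P = newton_poly m + half_poly m"
  define L where "L = alt_bump m / fact m + half_coeff m"
  have degree: "degree P \<le> m"
    unfolding P_def by (intro degree_add_le degree_newton_poly degree_half_poly)
  have coeff: "coeff P m = of_real L"
    using assms by (simp add: P_def L_def coeff_newton_poly coeff_half_poly)
  have "\<forall>j\<in>{..<m}. \<exists>d. 0 < d \<and> d < 1 \<and> eps_poly m (real j + 2 + d) = 0"
    using eps_poly_root_exists by simp
  from bchoice[OF this] obtain d
    where d: "\<And>j. j < m \<Longrightarrow> 0 < d j \<and> d j < 1 \<and> eps_poly m (real j + 2 + d j) = 0"
    by auto
  define r where "r j = real j + 2 + d j" for j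
  have r_inj: "i = j" if "i < m" "r i = real j + 2 + x" "0 < x" "x < 1" for i j x
    using d[OF that(1)] that unfolding r_def by linarith
  have "smult ((-1) ^ m) P = smult (coeff P m) (\<Prod>j<m. [:of_real (r j), -1:])"
  proof (rule poly_eq_linear_prod[OF degree])
    show "poly P (of_real (r j)) = 0" if "j < m" for j
      using d[OF that] eps_poly_eq_interpolation[of m "r j"] by (simp add: P_def r_def)
    show "inj_on (\<lambda>j. complex_of_real (r j)) {..<m}"
    proof (rule inj_onI)
      fix i j assume ij: "i \<in> {..<m}" "j \<in> {..<m}" "complex_of_real (r i) = of_real (r j)"
      then have "r i = real j + 2 + d j"
        by (simp only: of_real_eq_iff r_def[of j])
      then show "i = j"
        using ij d[of j] by (intro r_inj[of i j "d j"]) auto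
    qed
  qed
  then have P: "P = smult (of_real L) (\<Prod>j<m. [:of_real (r j), -1:])"
    using assms coeff by simp
  have "L \<noteq> 0"
  proof
    assume "L = 0"
    then have "P = 0" using P by simp
    then have "eps_poly m (real 0 + 2) = 0"
      using eps_poly_eq_interpolation[of m "real 0 + 2"] unfolding P_def by (metis of_real_eq_0_iff poly_0)
    then show False
      using eps_pos[of 0 m] by (subst (asm) eps_poly_node) auto
  qed
  have dshift: "dshift m j = d j" if "j < m" for j
    unfolding dshift_def
  proof (rule the_equality)
    show "0 < d j \<and> d j < 1 \<and> eps_poly m (real j + 2 + d j) = 0"
      using d[OF that] .
  next
    fix x assume x: "0 < x \<and> x < 1 \<and> eps_poly m (real j + 2 + x) = 0"
    have "poly P (of_real (real j + 2 + x)) = 0"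
      using eps_poly_eq_interpolation[of m "real j + 2 + x"] x unfolding P_def by (metis of_real_0)
    moreover have "poly P (of_real t) = of_real L * (\<Prod>i<m. of_real (r i - t))" for t
      unfolding P by (simp add: poly_prod)
    ultimately have "(\<Prod>i<m. complex_of_real (r i - (real j + 2 + x))) = 0"
      using \<open>L \<noteq> 0\<close> by (simp only: mult_eq_0_iff of_real_eq_0_iff simp_thms)
    then obtain i where i: "i < m" "r i = real j + 2 + x"
      unfolding prod_zero_iff[OF finite_lessThan] of_real_eq_0_iff by auto
    then have "i = j" using r_inj x by blast
    then show "x = d j" using i by (simp add: r_def)
  qed
  show "0 < dshift m j \<and> dshift m j < 1" if "j < m" for j
    using d[OF that] dshift[OF that] by simp
  have "(\<Prod>j<m. [:complex_of_real (r j), -1:]) = (\<Prod>j<m. [:of_real (node m j), -1:])"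
    by (intro prod.cong refl) (simp add: r_def node_def dshift)
  then show "newton_poly m + half_poly m =
      smult (of_real (alt_bump m / fact m + half_coeff m)) (\<Prod>j<m. [:of_real (node m j), -1:])"
    using P unfolding P_def L_def by simp
qed

lemma eta_approx_eq_newton:
  assumes "even m" "0 < m"
  shows "eta_approx m s = poly (newton_poly m) s + poly (newton_poly m) (1 - s)"
proof -
  have "chi (m + 1) / fact (m + 1) = alt_bump m / fact m"
    using chi_eq_alt_bump[OF assms(2)] by simp
  then have eta: "eta_approx m s = of_real (alt_bump m / fact m + half_coeff m) * symfact_d m s -
      of_real (half_coeff m) * symfact_half m s"
    unfolding eta_approx_def half_coeff_def by simp
  have poly: "poly (newton_poly m) z + of_real (half_coeff m) * (\<Prod>j<m. of_nat j + 5/2 - z) =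
      of_real (alt_bump m / fact m + half_coeff m) * (\<Prod>j<m. of_real (node m j) - z)" for z
    using arg_cong[OF dshift_props(2)[OF assms(1)], of "\<lambda>p. poly p z"]
    by (simp add: poly_half_poly poly_prod)
  have "symfact_d m s = (\<Prod>j<m. of_real (node m j) - s) + (\<Prod>j<m. of_real (node m j) - (1 - s))"
    by (simp add: symfact_d_def node_def algebra_simps)
  moreover have "symfact_half m s = (\<Prod>j<m. of_nat j + 5/2 - s) + (\<Prod>j<m. of_nat j + 5/2 - (1 - s))"
    unfolding symfact_half_def by (intro arg_cong2[of _ _ _ _ "(+)"] prod.cong refl) (simp add: algebra_simps)
  ultimately have "eta_approx m s =
      (of_real (alt_bump m / fact m + half_coeff m) * (\<Prod>j<m. of_real (node m j) - s) +
       of_real (alt_bump m / fact m + half_coeff m) * (\<Prod>j<m. of_real (node m j) - (1 - s))) -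
      (of_real (half_coeff m) * (\<Prod>j<m. of_nat j + 5/2 - s) +
       of_real (half_coeff m) * (\<Prod>j<m. of_nat j + 5/2 - (1 - s)))"
    unfolding eta by (simp only: distrib_left)
  then show ?thesis
    unfolding poly[symmetric] by simp
qed

section \<open>Zeros of symmetrized products and the main result\<close>

text \<open>If \<open>Re z < 1/2\<close>, then \<open>1 - z\<close> is closer than \<open>z\<close> to every real \<open>a > 1/2\<close>, because
  \<open>(a - r)\<^sup>2 - (a - (1 - r))\<^sup>2 = (1 - 2r)(2a - 1)\<close> for \<open>r = Re z\<close>.\<close>

lemma symmetrized_prod_zero_Re:
  fixes a :: "nat \<Rightarrow> real" and s :: complex
  assumes "0 < m" and a: "\<And>j. j < m \<Longrightarrow> 1/2 < a j"
    and zero: "(\<Prod>j<m. of_real (a j) - s) + (\<Prod>j<m. of_real (a j) - (1 - s)) = 0"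
  shows "Re s = 1/2"
proof -
  have no_zero: False
    if less: "Re z < 1/2" and zero: "(\<Prod>j<m. of_real (a j) - z) + (\<Prod>j<m. of_real (a j) - (1 - z)) = 0"
    for z :: complex
  proof -
    have closer: "norm (of_real (a j) - (1 - z)) < norm (of_real (a j) - z)" if "j < m" for j
    proof -
      have "0 < (1 - 2 * Re z) * (2 * a j - 1)"
        using less a[OF that] by (intro mult_pos_pos) auto
      then have "(a j - (1 - Re z))\<^sup>2 < (a j - Re z)\<^sup>2"
        by (simp add: power2_eq_square algebra_simps)
      then show ?thesis
        by (simp add: cmod_def)
    qed
    have "0 < norm (of_real (a j) - z)" if "j < m" for j
      using closer[OF that] by (rule le_less_trans[OF norm_ge_zero])
    then have "(\<Prod>j<m. norm (of_real (a j) - (1 - z))) < (\<Prod>j<m. norm (of_real (a j) - z))"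
      using assms(1) closer by (intro prod_mono_strict[of 0]) (simp_all add: less_imp_le)
    then show False
      using zero by (metis add_eq_0_iff less_irrefl norm_minus_cancel prod_norm)
  qed
  have "\<not> Re s < 1/2" using no_zero[of s] zero by blast
  moreover have "\<not> Re (1 - s) < 1/2" using no_zero[of "1 - s"] zero by (auto simp: add.commute)
  ultimately show ?thesis by simp
qed

theorem mainTheorem8:
  "(\<forall>s::complex. 0 < Re s \<and> Re s < 1 \<longrightarrow>
      (\<lambda>n. eta_approx (2 * Suc n) s) \<longlonglongrightarrow> dirichlet_eta s + dirichlet_eta (1 - s)) \<and>
   (\<forall>m::nat. even m \<and> 0 < m \<longrightarrow>
      (\<forall>s::complex. symfact_d m s = 0 \<longrightarrow> Re s = 1/2) \<and>
      (\<forall>s::complex. symfact_half m s = 0 \<longrightarrow> Re s = 1/2))"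
proof (intro conjI allI impI)
  fix s :: complex assume s: "0 < Re s \<and> Re s < 1"
  have newton: "(\<lambda>n. poly (newton_poly (2 * Suc n)) z) \<longlonglongrightarrow> dirichlet_eta z" if "0 < Re z" for z
  proof -
    have "(\<lambda>m. poly (newton_poly m) z) \<longlonglongrightarrow> dirichlet_eta z"
      unfolding poly_newton_poly using newton_series_sums_eta[OF that] by (simp add: sums_def_le)
    then show ?thesis
      by (rule filterlim_compose) (auto intro!: filterlim_subseq simp: strict_mono_def)
  qed
  have "(\<lambda>n. poly (newton_poly (2 * Suc n)) s + poly (newton_poly (2 * Suc n)) (1 - s))
      \<longlonglongrightarrow> dirichlet_eta s + dirichlet_eta (1 - s)"
    using s by (intro tendsto_add newton) auto
  then show "(\<lambda>n. eta_approx (2 * Suc n) s) \<longlonglongrightarrow> dirichlet_eta s + dirichlet_eta (1 - s)"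
    by (simp add: eta_approx_eq_newton)
next
  fix m :: nat and s :: complex
  assume m: "even m \<and> 0 < m" and "symfact_d m s = 0"
  then have "(\<Prod>j<m. of_real (node m j) - s) + (\<Prod>j<m. of_real (node m j) - (1 - s)) = 0"
    by (simp add: symfact_d_def node_def algebra_simps)
  then show "Re s = 1/2"
  proof (rule symmetrized_prod_zero_Re[rotated 2])
    show "1/2 < node m j" if "j < m" for j
      using dshift_props(1)[of m j] m that by (simp add: node_def)
  qed (use m in auto)
next
  fix m :: nat and s :: complex
  assume m: "even m \<and> 0 < m" and "symfact_half m s = 0"
  then have "(\<Prod>j<m. of_real (real j + 5/2) - s) + (\<Prod>j<m. of_real (real j + 5/2) - (1 - s)) = 0"
    by (simp add: symfact_half_def algebra_simps)
  then show "Re s = 1/2"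
    by (rule symmetrized_prod_zero_Re[rotated 2]) (use m in auto)
qed

end
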